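(* For every finite graph $G$: (i) if $G$ admits a linear ordering of its vertices avoiding the pattern $P_{ab}$, then $G$ is a grounded stairs graph; and (ii) if $G$ is a grounded stairs graph, then $G$ admits a linear ordering of its vertices avoiding the pattern $P_{abc}$. In other words, $\mathcal{C}_{ab}\subseteq \text{grounded stairs graphs}\subseteq \mathcal{C}_{abc}$.
   Context: Patterns: for $S\subseteq\{a,b,c,d\}$, where $a=(1,2)$, $b=(2,3)$, $c=(3,4)$, $d=(1,4)$ denote pairs of positions among four ordered positions $1<2<3<4$, the pattern $P_S$ requires that positions $(1,3)$ and $(2,4)$ be edges and every pair in $S$ be a non-edge; other pairs are unconstrained. A linear ordering $<$ of $V(G)$ avoids $P_S$ if there are no four vertices $x_1<x_2<x_3<x_4$ with $x_1x_3,x_2x_4\in E(G)$ and $x_ix_j\notin E(G)$ for every $(i,j)\in S$; $\mathcal{C}_S$ is the class of graphs admitting such an ordering. Grounded stairs: fix a horizontal grounding line; a stair is a finite polygonal curve made of alternating horizontal and vertical segments forming stairs going up and to the right (both coordinates non-decreasing along it), starting on the grounding line and lying in the closed half-plane above it; in a configuration no two stairs touch the grounding line at the same point. A grounded stairs graph is the intersection graph (vertices = stairs, adjacency = nonempty intersection) of such a configuration. *)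

theory Defs
  imports "HOL-Analysis.Analysis" "Graph_Theory.Pair_Digraph"
begin

(* Finite simple graphs are represented by pair_graph: a finite vertex set pverts G with a
   symmetric, loop-free arc relation parcs G; {u, v} is an edge iff (u, v) \<in> parcs G. *)

abbreviation adjacent :: "'v pair_pre_digraph \<Rightarrow> 'v \<Rightarrow> 'v \<Rightarrow> bool" where
  "adjacent G u v \<equiv> (u, v) \<in> parcs G"

definition pos_a :: "nat \<times> nat" where "pos_a = (1, 2)"
definition pos_b :: "nat \<times> nat" where "pos_b = (2, 3)"
definition pos_c :: "nat \<times> nat" where "pos_c = (3, 4)"
definition pos_d :: "nat \<times> nat" where "pos_d = (1, 4)"

(* Orders are reflexive relations, as in linear_order_on. *)
definition strictly_before :: "'v rel \<Rightarrow> 'v \<Rightarrow> 'v \<Rightarrow> bool" where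
  "strictly_before r u v \<longleftrightarrow> (u, v) \<in> r \<and> u \<noteq> v"

(* The intended S are the subsets of {pos_a, pos_b, pos_c, pos_d}. *)
definition occurs_pattern ::
    "(nat \<times> nat) set \<Rightarrow> 'v pair_pre_digraph \<Rightarrow> 'v rel \<Rightarrow> bool" where
  "occurs_pattern S G r \<longleftrightarrow>
     (\<exists>x :: nat \<Rightarrow> 'v.
        (\<forall>i\<in>{1..4}. x i \<in> pverts G) \<and>
        strictly_before r (x 1) (x 2) \<and> strictly_before r (x 2) (x 3) \<and>
        strictly_before r (x 3) (x 4) \<and>
        adjacent G (x 1) (x 3) \<and> adjacent G (x 2) (x 4) \<and>
        (\<forall>(i, j)\<in>S. \<not> adjacent G (x i) (x j)))"

definition in_pattern_class :: "(nat \<times> nat) set \<Rightarrow> 'v pair_pre_digraph \<Rightarrow> bool" where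
  "in_pattern_class S G \<longleftrightarrow>
     (\<exists>r. linear_order_on (pverts G) r \<and> \<not> occurs_pattern S G r)"

definition grounding_line :: "real \<Rightarrow> (real \<times> real) set" where
  "grounding_line h = {p. snd p = h}"

definition closed_upper_half_plane :: "real \<Rightarrow> (real \<times> real) set" where
  "closed_upper_half_plane h = {p. h \<le> snd p}"

definition right_step :: "real \<times> real \<Rightarrow> real \<times> real \<Rightarrow> bool" where
  "right_step p q \<longleftrightarrow> snd p = snd q \<and> fst p < fst q"

definition up_step :: "real \<times> real \<Rightarrow> real \<times> real \<Rightarrow> bool" where
  "up_step p q \<longleftrightarrow> fst p = fst q \<and> snd p < snd q"

definition alternating_stair_vertices :: "(real \<times> real) list \<Rightarrow> bool" where
  "alternating_stair_vertices ps \<longleftrightarrow>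
     length ps \<ge> 2 \<and>
     (\<forall>i. Suc i < length ps \<longrightarrow>
        right_step (ps ! i) (ps ! Suc i) \<or> up_step (ps ! i) (ps ! Suc i)) \<and>
     (\<forall>i. Suc (Suc i) < length ps \<longrightarrow>
        (right_step (ps ! i) (ps ! Suc i) \<longleftrightarrow> up_step (ps ! Suc i) (ps ! Suc (Suc i))))"

definition polygonal_curve :: "(real \<times> real) list \<Rightarrow> (real \<times> real) set" where
  "polygonal_curve ps =
     (\<Union>i\<in>{i. Suc i < length ps}. closed_segment (ps ! i) (ps ! Suc i))"

(* The first segment may be horizontal, in which case it runs along the grounding line. *)
definition grounded_stair :: "real \<Rightarrow> (real \<times> real) set \<Rightarrow> bool" where
  "grounded_stair h C \<longleftrightarrow>
     (\<exists>ps. alternating_stair_vertices ps \<and> hd ps \<in> grounding_line h \<and>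
        C = polygonal_curve ps \<and> C \<subseteq> closed_upper_half_plane h)"

definition grounded_stairs_graph :: "real \<Rightarrow> 'v pair_pre_digraph \<Rightarrow> bool" where
  "grounded_stairs_graph h G \<longleftrightarrow>
     (\<exists>C :: 'v \<Rightarrow> (real \<times> real) set.
        (\<forall>v\<in>pverts G. grounded_stair h (C v)) \<and>
        (\<forall>u\<in>pverts G. \<forall>v\<in>pverts G. u \<noteq> v \<longrightarrow>
           C u \<inter> C v \<inter> grounding_line h = {}) \<and>
        (\<forall>u\<in>pverts G. \<forall>v\<in>pverts G. u \<noteq> v \<longrightarrow>
           (adjacent G u v \<longleftrightarrow> C u \<inter> C v \<noteq> {})))"

end

theory Submission
  imports Defs
begin

text \<open>
  From an ordering to stairs: the stair of vertex \<open>i\<close> starts in column \<open>i\<close> and ends at the column of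
  its last neighbour. In column \<open>k\<close> all stairs still alive rise, and they are rearranged so that the
  neighbours of \<open>k\<close> lie below the top of the first riser of \<open>k\<close> and the non-neighbours above it. The
  avoided pattern says exactly that only adjacent stairs have to exchange their order in such a
  rearrangement. Within a column the risers are sorted by index, so that of two non-adjacent stairs
  the upper one rises first and no accidental crossing arises.

  From stairs to an ordering: order the stairs by their starting points. A stair can be parametrized
  by \<open>t = x + y\<close>. If two stairs are disjoint, then \<open>x - y\<close>, as a function of \<open>t\<close>, is smaller on the one
  starting further left for all common \<open>t\<close>: this holds where the second one starts, and the
  intermediate value theorem propagates it. If stairs \<open>1 < 2 < 3 < 4\<close> formed the pattern, then stair
  2 would lie between 1 and 3, so would end before 1 and 3 meet, and 3 would separate it from 4.
\<close>

section \<open>Stairs as polygons with axis-parallel sides\<close>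

lemma closed_segment_horizontal:
  fixes a b y :: real
  assumes "a \<le> b"
  shows "closed_segment (a, y) (b, y) = {a..b} \<times> {y}"
proof -
  have "closed_segment (a, y) (b, y) = (\<lambda>x. (x, y)) ` closed_segment a b"
    by (auto simp: closed_segment_def image_iff simp flip: distrib_right)
  then show ?thesis
    using assms by (auto simp: closed_segment_eq_real_ivl)
qed

lemma closed_segment_vertical:
  fixes x a b :: real
  assumes "a \<le> b"
  shows "closed_segment (x, a) (x, b) = {x} \<times> {a..b}"
proof -
  have "closed_segment (x, a) (x, b) = Pair x ` closed_segment a b"
    by (auto simp: closed_segment_def image_iff simp flip: distrib_right)
  then show ?thesis
    using assms by (auto simp: closed_segment_eq_real_ivl)
qed

text \<open>The corners are (X 0, Y 0), (X 0, Y 1), (X 1, Y 1), ..., (X n, Y n). The first side is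
  vertical, so with \<open>Y\<close> strictly increasing only the first corner has height
  \<open>Y 0\<close>.\<close>

definition stair :: "(nat \<Rightarrow> real) \<Rightarrow> (nat \<Rightarrow> real) \<Rightarrow> nat \<Rightarrow> (real \<times> real) list" where
  "stair X Y n = map (\<lambda>m. (X (m div 2), Y (Suc m div 2))) [0..<2 * n + 1]"

lemma length_stair [simp]: "length (stair X Y n) = 2 * n + 1"
  by (simp add: stair_def)

lemma nth_stair: "m < 2 * n + 1 \<Longrightarrow> stair X Y n ! m = (X (m div 2), Y (Suc m div 2))"
  unfolding stair_def by (subst nth_map) (auto simp del: upt_Suc)

lemma hd_stair: "hd (stair X Y n) = (X 0, Y 0)"
  using nth_stair[of 0 n X Y] by (simp add: hd_conv_nth flip: length_greater_0_conv)

lemma stair_step: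
  assumes "strict_mono X" "strict_mono Y" "Suc m < 2 * n + 1"
  shows "up_step (stair X Y n ! m) (stair X Y n ! Suc m) \<longleftrightarrow> even m"
    and "right_step (stair X Y n ! m) (stair X Y n ! Suc m) \<longleftrightarrow> odd m"
  using assms
  by (cases "even m"; auto simp: nth_stair up_step_def right_step_def strict_mono_less
      elim!: evenE oddE)+

lemma alternating_stair_vertices_stair:
  assumes "strict_mono X" "strict_mono Y" "0 < n"
  shows "alternating_stair_vertices (stair X Y n)"
  unfolding alternating_stair_vertices_def
  using assms by (auto simp: stair_step)

lemma polygonal_curve_stair:
  assumes "strict_mono X" "strict_mono Y"
  shows "polygonal_curve (stair X Y n) =
    (\<Union>t<n. {X t} \<times> {Y t..Y (Suc t)} \<union> {X t..X (Suc t)} \<times> {Y (Suc t)})"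
proof -
  have le: "X t \<le> X (Suc t)" "Y t \<le> Y (Suc t)" for t
    using assms by (simp_all add: strict_mono_less_eq)
  have idx: "{m. Suc m < 2 * n + 1} = (\<Union>t<n. {2 * t, Suc (2 * t)})"
  proof (intro set_eqI iffI)
    fix m assume "m \<in> {m. Suc m < 2 * n + 1}"
    then have "m div 2 < n" "m = 2 * (m div 2) \<or> m = Suc (2 * (m div 2))" by auto
    then show "m \<in> (\<Union>t<n. {2 * t, Suc (2 * t)})" by blast
  qed auto
  have "polygonal_curve (stair X Y n) =
    (\<Union>t<n. closed_segment (X t, Y t) (X t, Y (Suc t)) \<union>
           closed_segment (X t, Y (Suc t)) (X (Suc t), Y (Suc t)))"
    unfolding polygonal_curve_def length_stair idx by (simp add: nth_stair)
  then show ?thesis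
    by (simp add: closed_segment_horizontal closed_segment_vertical le)
qed

lemma grounded_stair_stair:
  assumes "strict_mono X" "strict_mono Y" "0 < n"
  shows "grounded_stair (Y 0) (polygonal_curve (stair X Y n))"
proof -
  have "Y 0 \<le> Y t" for t using assms(2) by (simp add: strict_mono_less_eq)
  then have "polygonal_curve (stair X Y n) \<subseteq> closed_upper_half_plane (Y 0)"
    unfolding polygonal_curve_stair[OF assms(1,2)] closed_upper_half_plane_def
    by (auto intro: order_trans[OF \<open>\<And>t. Y 0 \<le> Y t\<close>])
  then show ?thesis
    unfolding grounded_stair_def
    using alternating_stair_vertices_stair[OF assms] by (auto simp: hd_stair grounding_line_def)
qed

section \<open>Stairs built from an ordering that avoids P_ab\<close>

locale avoiding_graph =
  fixes N :: nat and A :: "nat \<Rightarrow> nat \<Rightarrow> bool" and h :: real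
  assumes bounded: "A i j \<Longrightarrow> i < N \<and> j < N"
    and avoiding: "\<lbrakk>i < j; j < k; k < l; A i k; A j l\<rbrakk> \<Longrightarrow> A i j \<or> A j k"
begin

text \<open>Inserting \<open>i\<close> keeps the maximum defined: without later neighbours the value
  is \<open>i\<close>, and the stair rises only in its own column.\<close>

definition last_nbr :: "nat \<Rightarrow> nat" where
  "last_nbr i = Max ({i} \<union> {j. i < j \<and> A i j})"

text \<open>Orders the stairs met in column \<open>k\<close> from bottom to top: the neighbours of \<open>k\<close>, then \<open>k\<close>,
  then its non-neighbours, each group by decreasing index.\<close>
definition rank :: "nat \<Rightarrow> nat \<Rightarrow> nat" where
  "rank i k = (if i = k then N else if A i k then N - i else 2 * N - i)"

text \<open>Column \<open>k = i + t\<close> begins at \<open>k * N\<close> and has width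
  \<open>N\<close>; the offset \<open>i\<close> sorts the risers inside it by index.\<close>

definition xpos :: "nat \<Rightarrow> nat \<Rightarrow> real" where
  "xpos i t = real ((i + t) * N + i)"

text \<open>The level of stair \<open>i\<close> after its rise in column \<open>k\<close>. Each
  column owns a band of \<open>2 * N\<close> levels, within which \<open>rank\<close> orders the
  stairs.\<close>

definition height :: "nat \<Rightarrow> nat \<Rightarrow> real" where
  "height i k = h + real (2 * N * k + rank i k)"

text \<open>The index shift reflects that riser \<open>t\<close> stands in column
  \<open>i + t\<close> and ends at \<open>ypos i (Suc t) = height i (i + t)\<close>.\<close>

definition ypos :: "nat \<Rightarrow> nat \<Rightarrow> real" where
  "ypos i t = (case t of 0 \<Rightarrow> h | Suc s \<Rightarrow> height i (i + s))"

text \<open>There is one riser per column from \<open>i\<close> to \<open>last_nbr i\<close>, and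
  the horizontal side after the last riser still reaches the place where the last neighbour
  starts.\<close>

definition curve :: "nat \<Rightarrow> (real \<times> real) set" where
  "curve i = polygonal_curve (stair (xpos i) (ypos i) (Suc (last_nbr i - i)))"

lemma finite_nbrs: "finite ({i} \<union> {j. i < j \<and> A i j})"
  using finite_subset[of "{j. i < j \<and> A i j}" "{..<N}"] bounded by auto

lemma last_nbr_ge: "i \<le> last_nbr i"
  unfolding last_nbr_def using finite_nbrs by (intro Max_ge) auto

lemma nbr_le_last_nbr: "i < j \<Longrightarrow> A i j \<Longrightarrow> j \<le> last_nbr i"
  unfolding last_nbr_def using finite_nbrs by (intro Max_ge) auto

lemma adjacent_last_nbr: "i < last_nbr i \<Longrightarrow> A i (last_nbr i)"
  using Max_in[OF finite_nbrs, of i] unfolding last_nbr_def[symmetric] by auto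

lemma rank_bounds: "i < N \<Longrightarrow> 0 < rank i k \<and> rank i k \<le> 2 * N"
  by (auto simp: rank_def)

lemma strict_mono_xpos: "i < N \<Longrightarrow> strict_mono (xpos i)"
  by (intro strict_monoI) (simp add: xpos_def)

text \<open>Ranks lie between 1 and \<open>2 * N\<close>, so the bands of successive columns do not
  overlap.\<close>

lemma strict_mono_height:
  assumes "i < N" shows "strict_mono (height i)"
  unfolding strict_mono_Suc_iff
proof
  fix k show "height i k < height i (Suc k)"
    using rank_bounds[OF assms, of k] rank_bounds[OF assms, of "Suc k"]
    unfolding height_def by (simp del: of_nat_add of_nat_mult)
qed

lemma height_gt: "i < N \<Longrightarrow> h < height i k"
  using rank_bounds[of i k] by (simp add: height_def del: of_nat_add of_nat_mult)

lemma strict_mono_ypos: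
  assumes "i < N" shows "strict_mono (ypos i)"
  unfolding strict_mono_Suc_iff ypos_def
  using height_gt[OF assms] strict_mono_height[OF assms]
  by (auto simp: strict_mono_less split: nat.split)

lemma curve_eq:
  assumes "i < N"
  shows "curve i = (\<Union>t<Suc (last_nbr i - i). {xpos i t} \<times> {ypos i t..ypos i (Suc t)} \<union>
    {xpos i t..xpos i (Suc t)} \<times> {ypos i (Suc t)})"
  unfolding curve_def
  by (rule polygonal_curve_stair[OF strict_mono_xpos[OF assms] strict_mono_ypos[OF assms]])

lemma grounded_stair_curve: "i < N \<Longrightarrow> grounded_stair h (curve i)"
  using grounded_stair_stair[OF strict_mono_xpos strict_mono_ypos, of i i "Suc (last_nbr i - i)"]
  unfolding curve_def by (simp add: ypos_def)

lemma curve_on_grounding_line: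
  assumes "i < N" "p \<in> curve i" "snd p = h"
  shows "fst p = real (i * N + i)"
proof -
  obtain t where t: "p \<in> {xpos i t} \<times> {ypos i t..ypos i (Suc t)} \<union>
      {xpos i t..xpos i (Suc t)} \<times> {ypos i (Suc t)}"
    using assms(2) unfolding curve_eq[OF assms(1)] by blast
  have gt: "h < ypos i (Suc s)" for s using height_gt[OF assms(1)] by (simp add: ypos_def)
  have "t = 0 \<and> fst p = xpos i t"
    using t assms(3) gt[of t] gt[of "t - 1"] by (cases t) auto
  then show ?thesis by (simp add: xpos_def)
qed

text \<open>For \<open>j = k\<close>, the non-neighbour \<open>i\<close> ranks above
  \<open>N\<close>, the rank of \<open>j\<close>. For \<open>j < k\<close>, if \<open>k\<close> were
  a neighbour of \<open>i\<close> but not of \<open>j\<close>, then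
  \<open>i < j < k < last_nbr j\<close> would be the forbidden pattern. So \<open>j\<close> is in
  the same group as \<open>i\<close> or in a lower one, and within a group the larger index is
  lower.\<close>

lemma height_less_of_nonadjacent:
  assumes "i < j" "j \<le> k" "k \<le> last_nbr j" "j < N" "\<not> A i j"
  shows "height j k < height i k"
proof -
  have "rank j k < rank i k"
  proof (cases "j = k")
    case True
    with assms show ?thesis by (auto simp: rank_def)
  next
    case False
    then have "j < k" using assms by simp
    have "A j k" if "A i k"
    proof (rule ccontr)
      assume "\<not> A j k"
      moreover have "A j (last_nbr j)" using adjacent_last_nbr \<open>j < k\<close> assms by simp
      ultimately have "k < last_nbr j" using assms by (metis order_le_less)
      with avoiding[OF \<open>i < j\<close> \<open>j < k\<close> _ that] \<open>A j (last_nbr j)\<close> \<open>\<not> A j k\<close> assms(5)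
      show False by blast
    qed
    with assms \<open>j < k\<close> show ?thesis by (auto simp: rank_def)
  qed
  then show ?thesis by (simp add: height_def)
qed

text \<open>A point of stair \<open>i\<close> lies weakly left of and above some
  (\<open>xpos i t\<close>, \<open>ypos i t\<close>); a point of stair \<open>j\<close> lies weakly
  right of and below some upper left corner (\<open>xpos j s\<close>,
  \<open>ypos j (Suc s)\<close>). For a common point the first coordinates force column
  \<open>j + s\<close> to precede column \<open>i + t\<close>, and there stair \<open>i\<close> is
  already too high.\<close>

lemma curves_disjoint:
  assumes "i < j" "j < N" "\<not> A i j"
  shows "curve i \<inter> curve j = {}"
proof (rule ccontr)
  assume "curve i \<inter> curve j \<noteq> {}"
  then obtain p where p: "p \<in> curve i" "p \<in> curve j" by blast
  have iN: "i < N" using assms by simp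
  have "\<exists>t. fst p \<le> xpos i t \<and> ypos i t \<le> snd p"
    using p(1) unfolding curve_eq[OF iN] by (auto simp: mem_Times_iff)
  then obtain t where t: "fst p \<le> xpos i t" "ypos i t \<le> snd p" by blast
  have "\<exists>s < Suc (last_nbr j - j). xpos j s \<le> fst p \<and> snd p \<le> ypos j (Suc s)"
    using p(2) strict_mono_ypos[OF assms(2)] unfolding curve_eq[OF assms(2)]
    by (auto simp: mem_Times_iff)
  then obtain s where s: "s < Suc (last_nbr j - j)" "xpos j s \<le> fst p" "snd p \<le> ypos j (Suc s)"
    by blast
  \<comment> \<open>Because \<open>i < j\<close>, the offsets inside the columns turn this weak
    inequality into a strict one between column numbers.\<close>
  have "real ((j + s) * N + j) \<le> real ((i + t) * N + i)"
    using s(2) t(1) by (simp add: xpos_def del: of_nat_add of_nat_mult)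
  then have "(j + s) * N + j \<le> (i + t) * N + i" by (simp only: of_nat_le_iff)
  then have "(j + s) * N < (i + t) * N" using assms(1) by linarith
  then have lt: "j + s < i + t" by simp
  then obtain t' where t': "t = Suc t'" using assms(1) by (cases t) auto
  have "snd p \<le> height j (j + s)" using s(3) by (simp add: ypos_def)
  also have "\<dots> < height i (j + s)"
    using height_less_of_nonadjacent[of i j "j + s"] s(1) last_nbr_ge[of j] assms by simp
  also have "\<dots> \<le> height i (i + t')"
    using strict_mono_height[OF iN] lt t' by (simp add: strict_mono_less_eq)
  also have "\<dots> \<le> snd p" using t(2) by (simp add: t' ypos_def)
  finally show False by simp
qed

lemma curves_meet:
  assumes "i < j" "A i j"
  shows "curve i \<inter> curve j \<noteq> {}"
proof -
  have N: "i < N" "j < N" using bounded[OF assms(2)] by auto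
  \<comment> \<open>The first riser of \<open>j\<close> climbs to rank \<open>N\<close> in column
    \<open>j\<close>. Its neighbour \<open>i\<close> leaves that column at rank \<open>N - i\<close>
    and crosses this riser horizontally, since \<open>i < j < N\<close>.\<close>
  let ?p = "(xpos j 0, height i j)"
  have "?p \<in> {xpos i (j - i)..xpos i (Suc (j - i))} \<times> {ypos i (Suc (j - i))}"
    using assms(1) N by (simp add: xpos_def ypos_def algebra_simps)
  moreover have "j - i < Suc (last_nbr i - i)"
    using nbr_le_last_nbr[OF assms] by simp
  ultimately have "?p \<in> curve i"
    unfolding curve_eq[OF N(1)] by blast
  moreover have "?p \<in> {xpos j 0} \<times> {ypos j 0..ypos j (Suc 0)}"
    using height_gt[OF N(1), of j] assms by (auto simp: ypos_def height_def rank_def)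
  then have "?p \<in> curve j"
    unfolding curve_eq[OF N(2)] by blast
  ultimately show ?thesis by blast
qed

end

section \<open>Passing between vertices and their positions in the ordering\<close>

lemma finite_linear_order_index:
  assumes "finite V" "linear_order_on V r"
  obtains f :: "'v \<Rightarrow> nat" where "inj_on f V" "\<And>u. u \<in> V \<Longrightarrow> f u < card V"
    "\<And>u v. u \<in> V \<Longrightarrow> v \<in> V \<Longrightarrow> f u < f v \<Longrightarrow> strictly_before r u v"
proof -
  \<comment> \<open>The number of strict predecessors is the position, counted from 0.\<close>
  define f where "f u = card {w \<in> V. strictly_before r w u}" for u
  have refl: "(u, u) \<in> r" if "u \<in> V" for u
    using assms(2) that by (auto simp: order_on_defs refl_on_def)
  have trans: "trans r" and anti: "antisym r" and tot: "total_on V r"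
    using assms(2) by (auto simp: order_on_defs)
  have less: "f u < f v" if "u \<in> V" "v \<in> V" "strictly_before r u v" for u v
    unfolding f_def
  proof (rule psubset_card_mono)
    have "strictly_before r w v" if "strictly_before r w u" for w
      using that \<open>strictly_before r u v\<close> trans anti
      by (metis antisymD strictly_before_def transD)
    then show "{w \<in> V. strictly_before r w u} \<subset> {w \<in> V. strictly_before r w v}"
      using that by (auto simp: strictly_before_def)
  qed (use assms(1) in auto)
  have cases: "u = v \<or> strictly_before r u v \<or> strictly_before r v u" if "u \<in> V" "v \<in> V" for u v
    using tot that by (auto simp: total_on_def strictly_before_def)
  show thesis
  proof (rule that[of f])
    show "inj_on f V" using cases less by (intro inj_onI) (metis less_irrefl)
    show "f u < card V" if "u \<in> V" for u
      unfolding f_def using that assms(1)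
      by (intro psubset_card_mono) (auto simp: strictly_before_def)
    show "strictly_before r u v" if "u \<in> V" "v \<in> V" "f u < f v" for u v
      using cases[OF that(1,2)] less[OF that(2,1)] that(3) by auto
  qed
qed

lemma occurs_patternI:
  assumes "x1 \<in> pverts G" "x2 \<in> pverts G" "x3 \<in> pverts G" "x4 \<in> pverts G"
    and "strictly_before r x1 x2" "strictly_before r x2 x3" "strictly_before r x3 x4"
    and "adjacent G x1 x3" "adjacent G x2 x4" "\<not> adjacent G x1 x2" "\<not> adjacent G x2 x3"
  shows "occurs_pattern {pos_a, pos_b} G r"
  unfolding occurs_pattern_def
proof (intro exI conjI)
  let ?x = "\<lambda>i :: nat. if i = 1 then x1 else if i = 2 then x2 else if i = 3 then x3 else x4"
  show "\<forall>i\<in>{1..4}. ?x i \<in> pverts G" using assms by simp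
  show "\<forall>(i, j)\<in>{pos_a, pos_b}. \<not> adjacent G (?x i) (?x j)"
    using assms by (simp add: pos_a_def pos_b_def)
qed (use assms in simp_all)

lemma grounded_stairs_graph_if_avoiding_ab:
  assumes "pair_graph G" "in_pattern_class {pos_a, pos_b} G"
  shows "grounded_stairs_graph h G"
proof -
  interpret pair_graph G by fact
  obtain r where r: "linear_order_on (pverts G) r" "\<not> occurs_pattern {pos_a, pos_b} G r"
    using assms(2) by (auto simp: in_pattern_class_def)
  obtain f :: "'a \<Rightarrow> nat" where f: "inj_on f (pverts G)"
    "\<And>u. u \<in> pverts G \<Longrightarrow> f u < card (pverts G)"
    "\<And>u v. u \<in> pverts G \<Longrightarrow> v \<in> pverts G \<Longrightarrow> f u < f v \<Longrightarrow> strictly_before r u v"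
    using finite_linear_order_index[OF pair_finite_verts r(1)] by blast
  \<comment> \<open>The existential makes \<open>A\<close> false on numbers that are not positions,
    as \<open>bounded\<close> demands; injectivity of \<open>f\<close> makes it agree with adjacency
    on vertices.\<close>
  define A where "A i j \<longleftrightarrow> (\<exists>u v. i = f u \<and> j = f v \<and> adjacent G u v)" for i j
  have verts: "u \<in> pverts G \<and> v \<in> pverts G" if "adjacent G u v" for u v
    using that in_arcsD1 in_arcsD2 by blast
  have A_iff: "A (f u) (f v) \<longleftrightarrow> adjacent G u v" if "u \<in> pverts G" "v \<in> pverts G" for u v
    unfolding A_def using that verts f(1) by (metis inj_onD)
  interpret avoiding_graph "card (pverts G)" A h
  proof
    show "i < card (pverts G) \<and> j < card (pverts G)" if "A i j" for i j
      using that f(2) verts unfolding A_def by blast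
    show "A i j \<or> A j k" if "i < j" "j < k" "k < l" "A i k" "A j l" for i j k l
    proof -
      obtain x1 x3 where x13: "i = f x1" "k = f x3" "adjacent G x1 x3"
        using \<open>A i k\<close> unfolding A_def by blast
      obtain x2 x4 where x24: "j = f x2" "l = f x4" "adjacent G x2 x4"
        using \<open>A j l\<close> unfolding A_def by blast
      note V = verts[OF x13(3)] verts[OF x24(3)]
      show ?thesis
        using occurs_patternI[of x1 G x2 x3 x4 r] r(2) that V x13 x24 f(3) A_iff by auto
    qed
  qed
  have sym: "adjacent G u v \<longleftrightarrow> adjacent G v u" for u v
    using arcs_symmetric by blast
  have adj: "adjacent G u v \<longleftrightarrow> curve (f u) \<inter> curve (f v) \<noteq> {}"
    if "u \<in> pverts G" "v \<in> pverts G" "f u < f v" for u v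
    using curves_meet[of "f u" "f v"] curves_disjoint[of "f u" "f v"] that A_iff f(2) by metis
  show ?thesis
    unfolding grounded_stairs_graph_def
  proof (intro exI[of _ "curve \<circ> f"] conjI ballI impI)
    fix u assume u: "u \<in> pverts G"
    then show "grounded_stair h ((curve \<circ> f) u)" using grounded_stair_curve f(2) by simp
    fix v assume v: "v \<in> pverts G" and "u \<noteq> v"
    then consider "f u < f v" | "f v < f u" using f(1) u by (meson inj_onD linorder_neqE_nat)
    note less = this
    show "adjacent G u v \<longleftrightarrow> (curve \<circ> f) u \<inter> (curve \<circ> f) v \<noteq> {}"
      using less adj[OF u v] adj[OF v u] sym[of u v] by cases (auto simp: Int_commute)
    \<comment> \<open>These are the starting abscissae; they differ since
      \<open>k * card (pverts G) + k\<close> is strictly increasing in \<open>k\<close>.\<close>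
    have "f u * card (pverts G) + f u \<noteq> f v * card (pverts G) + f v"
      using less by cases (metis add_less_le_mono add_mono_thms_linordered_field(4)
          less_irrefl less_imp_le mult_le_mono1)+
    then show "(curve \<circ> f) u \<inter> (curve \<circ> f) v \<inter> grounding_line h = {}"
      using curve_on_grounding_line[OF f(2)[OF u]] curve_on_grounding_line[OF f(2)[OF v]]
      by (fastforce simp: grounding_line_def simp del: of_nat_add of_nat_mult)
  qed
qed

section \<open>Parametrization of a stair by x + y\<close>

lemma polygonal_curve_Cons_Cons:
  "polygonal_curve (p # q # ps) = closed_segment p q \<union> polygonal_curve (q # ps)"
proof -
  have "{i. Suc i < length (p # q # ps)} = insert 0 (Suc ` {i. Suc i < length (q # ps)})"
    by (auto simp: image_iff) (metis Suc_less_eq not0_implies_Suc)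
  then show ?thesis by (simp add: polygonal_curve_def)
qed

text \<open>Right steps and up steps both increase this value strictly, so it can serve as the
  parameter along a stair.\<close>

definition diag :: "real \<times> real \<Rightarrow> real" where
  "diag p = fst p + snd p"

text \<open>Induction glues an affine piece for the first side to the parametrization of the rest.
  The head is inserted because a one-vertex list has an empty \<open>polygonal_curve\<close>,
  whereas its parameter interval is a single point.\<close>

lemma polygonal_curve_parametrization:
  assumes "ps \<noteq> []" "successively (\<lambda>p q. diag p < diag q) ps"
  shows "\<exists>g. continuous_on {diag (hd ps)..diag (last ps)} g \<and>
    g ` {diag (hd ps)..diag (last ps)} = insert (hd ps) (polygonal_curve ps) \<and>
    g (diag (hd ps)) = hd ps \<and>
    (\<forall>t\<in>{diag (hd ps)..diag (last ps)}. diag (g t) = t)"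
  using assms
proof (induction ps rule: induct_list012)
  case (2 p)
  show ?case by (rule exI[of _ "\<lambda>_. p"]) (auto simp: polygonal_curve_def)
next
  case (3 p q ps)
  define a b c where "a = diag p" "b = diag q" "c = diag (last (q # ps))"
  note abc = this
  obtain g where g: "continuous_on {b..c} g" "g ` {b..c} = insert q (polygonal_curve (q # ps))"
    "g b = q" "\<forall>t\<in>{b..c}. diag (g t) = t"
    using "3.IH"(2) "3.prems" unfolding abc by auto
  have "a < b" using "3.prems" by (simp add: abc)
  have "b \<le> c" using g(2) by (metis atLeastatMost_empty_iff image_is_empty insert_not_empty)
  \<comment> \<open>The affine map from \<open>p\<close> to \<open>q\<close>, scaled so that
    \<open>diag (l t) = t\<close>.\<close>
  define l where "l t = p + ((t - a) / (b - a)) *\<^sub>R (q - p)" for t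
  have l_b: "l b = q" using \<open>a < b\<close> by (simp add: l_def)
  have l_a: "l a = p" by (simp add: l_def)
  have "continuous_on {a..b} l"
    unfolding l_def using \<open>a < b\<close> by (intro continuous_intros) auto
  have diag_l: "diag (l t) = t" for t
  proof -
    have "diag (p + u *\<^sub>R (q - p)) = a + u * (b - a)" for u
      by (simp add: abc diag_def algebra_simps)
    then have "diag (l t) = a + (t - a) / (b - a) * (b - a)" unfolding l_def .
    then show ?thesis using \<open>a < b\<close> by simp
  qed
  have "l ` {a..b} = closed_segment p q"
  proof -
    have "(\<lambda>t. (t - a) / (b - a)) ` {a..b} = {0..1}"
    proof (intro subset_antisym subsetI)
      fix u :: real assume "u \<in> {0..1}"
      then have "u * (b - a) \<le> 1 * (b - a)"
        using \<open>a < b\<close> by (intro mult_right_mono) auto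
      then have "a + u * (b - a) \<le> b" by simp
      then show "u \<in> (\<lambda>t. (t - a) / (b - a)) ` {a..b}"
        using \<open>a < b\<close> \<open>u \<in> {0..1}\<close> by (intro image_eqI[of _ _ "a + u * (b - a)"]) auto
    qed (use \<open>a < b\<close> in auto)
    then have "closed_segment p q = (\<lambda>u. p + u *\<^sub>R (q - p)) ` (\<lambda>t. (t - a) / (b - a)) ` {a..b}"
      by (auto simp: closed_segment_def algebra_simps)
    then show ?thesis by (simp add: image_image l_def)
  qed
  \<comment> \<open>Both pieces take the value \<open>q\<close> at \<open>b\<close>, which gives
    continuity and makes the choice of branch there irrelevant.\<close>
  define g' where "g' t = (if t \<le> b then l t else g t)" for t
  have ivl: "{a..c} = {a..b} \<union> {b..c}" using \<open>a < b\<close> \<open>b \<le> c\<close> by auto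
  have "continuous_on {a..c} g'"
    unfolding g'_def ivl
    by (rule continuous_on_cases) (use \<open>continuous_on {a..b} l\<close> g l_b in auto)
  moreover have "g' ` {a..c} = insert p (polygonal_curve (p # q # ps))"
  proof -
    have "g' ` {a..b} = l ` {a..b}" by (rule image_cong) (auto simp: g'_def)
    moreover have "g' ` {b..c} = g ` {b..c}"
    proof (rule image_cong)
      show "g' t = g t" if "t \<in> {b..c}" for t
        using that l_b g(3) by (cases "t = b") (auto simp: g'_def)
    qed simp
    ultimately have "g' ` {a..c} = closed_segment p q \<union> insert q (polygonal_curve (q # ps))"
      unfolding ivl image_Un g(2) \<open>l ` {a..b} = closed_segment p q\<close> by simp
    then show ?thesis unfolding polygonal_curve_Cons_Cons by auto
  qed
  moreover have "g' a = p" using \<open>a < b\<close> l_a by (simp add: g'_def)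
  moreover have "\<forall>t\<in>{a..c}. diag (g' t) = t"
    using diag_l g(4) by (simp add: g'_def)
  ultimately show ?case unfolding abc by auto
qed simp

lemma grounded_stair_parametrization:
  assumes "grounded_stair h C"
  shows "\<exists>s e g. s \<le> e \<and> continuous_on {s..e} g \<and> g ` {s..e} = C \<and> snd (g s) = h \<and>
    (\<forall>t\<in>{s..e}. diag (g t) = t \<and> h \<le> snd (g t))"
proof -
  obtain ps where ps: "alternating_stair_vertices ps" "hd ps \<in> grounding_line h"
    "C = polygonal_curve ps" "C \<subseteq> closed_upper_half_plane h"
    using assms unfolding grounded_stair_def by blast
  have "successively (\<lambda>p q. diag p < diag q) ps"
    using ps(1) unfolding successively_conv_nth alternating_stair_vertices_def
    by (auto simp: right_step_def up_step_def diag_def; force)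
  moreover obtain p q ps' where ps': "ps = p # q # ps'"
    using ps(1) unfolding alternating_stair_vertices_def
    by (cases ps; cases "tl ps") auto
  ultimately obtain g where g: "continuous_on {diag p..diag (last ps)} g"
    "g ` {diag p..diag (last ps)} = insert p (polygonal_curve ps)" "g (diag p) = p"
    "\<forall>t\<in>{diag p..diag (last ps)}. diag (g t) = t"
    using polygonal_curve_parametrization[of ps] by auto
  \<comment> \<open>With at least two vertices, \<open>p\<close> is an end of the first side and
    hence already on the curve.\<close>
  have "insert p (polygonal_curve ps) = C"
    unfolding ps(3) ps' polygonal_curve_Cons_Cons by auto
  note img = g(2)[unfolded this]
  have "C \<noteq> {}" using \<open>insert p (polygonal_curve ps) = C\<close> by auto
  then have "diag p \<le> diag (last ps)"
    using img by (metis atLeastatMost_empty_iff image_is_empty)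
  moreover have "h \<le> snd (g t)" if "t \<in> {diag p..diag (last ps)}" for t
    using imageI[OF that, of g] img ps(4) by (auto simp: closed_upper_half_plane_def)
  ultimately show ?thesis
    using g img ps(2) ps' by (intro exI[of _ "diag p"] exI[of _ "diag (last ps)"] exI[of _ g])
      (auto simp: grounding_line_def)
qed

section \<open>The ordering of stairs by their starting points\<close>

lemma linear_order_on_vimage:
  fixes f :: "'v \<Rightarrow> real"
  assumes "inj_on f V"
  shows "linear_order_on V {(u, v). u \<in> V \<and> v \<in> V \<and> f u \<le> f v}"
  using assms
  by (auto simp: order_on_defs refl_on_def trans_def antisym_def total_on_def dest: inj_onD)

lemma avoiding_abc_if_grounded_stairs_graph:
  assumes "grounded_stairs_graph h G"
  shows "in_pattern_class {pos_a, pos_b, pos_c} G"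
proof -
  obtain C where
    "(\<forall>v\<in>pverts G. grounded_stair h (C v)) \<and>
     (\<forall>u\<in>pverts G. \<forall>v\<in>pverts G. u \<noteq> v \<longrightarrow> C u \<inter> C v \<inter> grounding_line h = {}) \<and>
     (\<forall>u\<in>pverts G. \<forall>v\<in>pverts G. u \<noteq> v \<longrightarrow> (adjacent G u v \<longleftrightarrow> C u \<inter> C v \<noteq> {}))"
    using assms unfolding grounded_stairs_graph_def by (elim exE)
  then have C: "\<And>v. v \<in> pverts G \<Longrightarrow> grounded_stair h (C v)"
    "\<And>u v. \<lbrakk>u \<in> pverts G; v \<in> pverts G; u \<noteq> v\<rbrakk> \<Longrightarrow> C u \<inter> C v \<inter> grounding_line h = {}"
    "\<And>u v. \<lbrakk>u \<in> pverts G; v \<in> pverts G; u \<noteq> v\<rbrakk> \<Longrightarrow> adjacent G u v \<longleftrightarrow> C u \<inter> C v \<noteq> {}"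
    by simp_all
  have "\<forall>v\<in>pverts G. \<exists>s e g. s \<le> e \<and> continuous_on {s..e} g \<and> g ` {s..e} = C v \<and>
      snd (g s) = h \<and> (\<forall>t\<in>{s..e}. diag (g t) = t \<and> h \<le> snd (g t))"
    using C(1) grounded_stair_parametrization by blast
  from this[unfolded bchoice_iff] obtain s e g where
    "\<forall>v\<in>pverts G. s v \<le> e v \<and> continuous_on {s v..e v} (g v) \<and> g v ` {s v..e v} = C v \<and>
      snd (g v (s v)) = h \<and> (\<forall>t\<in>{s v..e v}. diag (g v t) = t \<and> h \<le> snd (g v t))"
    by (elim exE)
  then have seg: "s v \<le> e v" "continuous_on {s v..e v} (g v)" "g v ` {s v..e v} = C v"
      "snd (g v (s v)) = h"
      "\<And>t. s v \<le> t \<Longrightarrow> t \<le> e v \<Longrightarrow> diag (g v t) = t"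
      "\<And>t. s v \<le> t \<Longrightarrow> t \<le> e v \<Longrightarrow> h \<le> snd (g v t)"
    if "v \<in> pverts G" for v
    using that by auto
  \<comment> \<open>Starting points have height \<open>h\<close>, so equal parameters would mean a
    shared point on the grounding line.\<close>
  have inj: "inj_on s (pverts G)"
  proof (rule inj_onI, rule ccontr)
    fix u v assume uv: "u \<in> pverts G" "v \<in> pverts G" "s u = s v" "u \<noteq> v"
    have "(s w - h, h) \<in> C w" if w: "w \<in> pverts G" for w
    proof -
      have "g w (s w) = (s w - h, h)"
        using seg(1,4)[OF w] seg(5)[OF w, of "s w"] by (simp add: diag_def prod_eq_iff)
      moreover have "g w (s w) \<in> C w"
        unfolding seg(3)[OF w, symmetric] using seg(1)[OF w] by simp
      ultimately show ?thesis by simp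
    qed
    from this[OF uv(1)] this[OF uv(2)]
    have "(s u - h, h) \<in> C u \<inter> C v \<inter> grounding_line h"
      using uv(3) by (simp add: grounding_line_def)
    then show False using C(2)[OF uv(1,2,4)] by simp
  qed
  \<comment> \<open>This is x - y; together with the parameter t = x + y it determines the
    point.\<close>
  define f where "f v t = fst (g v t) - snd (g v t)" for v t
  have meet: "\<exists>t. s u \<le> t \<and> s v \<le> t \<and> t \<le> e u \<and> t \<le> e v \<and> f u t = f v t"
    if V: "u \<in> pverts G" "v \<in> pverts G" and ne: "C u \<inter> C v \<noteq> {}" for u v
  proof -
    obtain z where z: "z \<in> C u" "z \<in> C v" using ne by blast
    obtain t where t: "s u \<le> t" "t \<le> e u" "g u t = z"
      using z(1) unfolding seg(3)[OF V(1), symmetric] by auto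
    obtain t' where t': "s v \<le> t'" "t' \<le> e v" "g v t' = z"
      using z(2) unfolding seg(3)[OF V(2), symmetric] by auto
    \<comment> \<open>The parameter is x + y of the point itself, so a common point has the same
      parameter on both stairs.\<close>
    have "t = t'" using t t' seg(5)[OF V(1), of t] seg(5)[OF V(2), of t'] by simp
    then show ?thesis using t t' by (intro exI[of _ t]) (simp add: f_def)
  qed
  have below: "f u t < f v t"
    if V: "u \<in> pverts G" "v \<in> pverts G" and "s u < s v" and "C u \<inter> C v = {}"
      and t: "s v \<le> t" "t \<le> e u" "t \<le> e v" for u v t
  proof (rule ccontr)
    assume "\<not> f u t < f v t"
    \<comment> \<open>At this parameter \<open>v\<close> has height \<open>h\<close> and
      \<open>u\<close> has height at least \<open>h\<close>, while x + y agrees. A failure of the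
      claim at \<open>t\<close> would then give a zero of the difference, hence a common
      point.\<close>
    have "f u (s v) \<le> f v (s v)"
      using seg(1,4)[OF V(2)] seg(5)[OF V(2), of "s v"] seg(5,6)[OF V(1), of "s v"]
        t \<open>s u < s v\<close>
      by (simp add: f_def diag_def)
    moreover have "continuous_on {s v..t} (\<lambda>x. f u x - f v x)"
      unfolding f_def using t \<open>s u < s v\<close>
      by (intro continuous_intros continuous_on_subset[OF seg(2)[OF V(1)]]
          continuous_on_subset[OF seg(2)[OF V(2)]]) auto
    ultimately obtain x where x: "s v \<le> x" "x \<le> t" "f u x - f v x = 0"
      using IVT'[of "\<lambda>x. f u x - f v x" "s v" 0 t] \<open>\<not> f u t < f v t\<close> t(1) by auto
    have "g u x = g v x"
      using x t seg(5)[OF V(1), of x] seg(5)[OF V(2), of x] \<open>s u < s v\<close>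
      by (simp add: f_def diag_def prod_eq_iff)
    moreover have "g u x \<in> C u" "g v x \<in> C v"
      using x t \<open>s u < s v\<close> seg(3)[OF V(1)] seg(3)[OF V(2)] by auto
    ultimately show False using \<open>C u \<inter> C v = {}\<close> by auto
  qed
  let ?r = "{(u, v). u \<in> pverts G \<and> v \<in> pverts G \<and> s u \<le> s v}"
  have "\<not> occurs_pattern {pos_a, pos_b, pos_c} G ?r"
  proof
    assume "occurs_pattern {pos_a, pos_b, pos_c} G ?r"
    then obtain x :: "nat \<Rightarrow> 'a" where x: "\<forall>i\<in>{1..4}. x i \<in> pverts G"
      "strictly_before ?r (x 1) (x 2)" "strictly_before ?r (x 2) (x 3)"
      "strictly_before ?r (x 3) (x 4)" "adjacent G (x 1) (x 3)" "adjacent G (x 2) (x 4)"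
      "\<not> adjacent G (x 1) (x 2)" "\<not> adjacent G (x 2) (x 3)" "\<not> adjacent G (x 3) (x 4)"
      unfolding occurs_pattern_def by (auto simp: pos_a_def pos_b_def pos_c_def)
    have V: "x 1 \<in> pverts G" "x 2 \<in> pverts G" "x 3 \<in> pverts G" "x 4 \<in> pverts G"
      using x(1) by auto
    have before: "s u < s v \<and> u \<noteq> v" if "strictly_before ?r u v" for u v
      using that inj by (auto simp: strictly_before_def less_le dest: inj_onD)
    have s: "s (x 1) < s (x 2)" "s (x 2) < s (x 3)" "s (x 3) < s (x 4)"
      using before[OF x(2)] before[OF x(3)] before[OF x(4)] by auto
    have disj: "C (x 1) \<inter> C (x 2) = {}" "C (x 2) \<inter> C (x 3) = {}" "C (x 3) \<inter> C (x 4) = {}"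
      using C(3) V x(7-9) before[OF x(2)] before[OF x(3)] before[OF x(4)] by blast+
    have "x 1 \<noteq> x 3" "x 2 \<noteq> x 4" using s by auto
    then have "C (x 1) \<inter> C (x 3) \<noteq> {}" "C (x 2) \<inter> C (x 4) \<noteq> {}"
      using C(3) V x(5,6) by blast+
    then obtain p q where
      p: "s (x 3) \<le> p" "p \<le> e (x 1)" "p \<le> e (x 3)" "f (x 1) p = f (x 3) p" and
      q: "s (x 4) \<le> q" "q \<le> e (x 2)" "q \<le> e (x 4)" "f (x 2) q = f (x 4) q"
      using meet V by meson
    \<comment> \<open>Otherwise stair 2 would be present at \<open>p\<close> and lie strictly
      between stairs 1 and 3, which meet there.\<close>
    have "e (x 2) < p"
      using below[OF V(1,2) s(1) disj(1), of p] below[OF V(2,3) s(2) disj(2), of p] p s by linarith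
    \<comment> \<open>Now \<open>q \<le> e (x 2) < p \<le> e (x 3)\<close>, so stair 3 is present at
      \<open>q\<close> and separates stairs 2 and 4, which meet there.\<close>
    then show False
      using below[OF V(2,3) s(2) disj(2), of q] below[OF V(3,4) s(3) disj(3), of q] p q s
      by linarith
  qed
  then show ?thesis
    unfolding in_pattern_class_def using linear_order_on_vimage[OF inj] by blast
qed

theorem theorem4:
  fixes G :: "'v pair_pre_digraph" and h :: real
  assumes "pair_graph G"
  shows "(in_pattern_class {pos_a, pos_b} G \<longrightarrow> grounded_stairs_graph h G) \<and>
         (grounded_stairs_graph h G \<longrightarrow> in_pattern_class {pos_a, pos_b, pos_c} G)"
  using grounded_stairs_graph_if_avoiding_ab[OF assms] avoiding_abc_if_grounded_stairs_graph
  by blast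

end
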